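(* Let $m\ge 1$ be the number of crews. Consider the following algorithm. Let $E^{LP}=(E^{LP}_j)_{j\in L^D}$ be any feasible solution of the constraints $$E_j\ge p_j\quad\text{for all } j\in L^D;\qquad E_j\ge E_i\quad\text{for every edge } i\to j \text{ of the soft precedence graph } P;$$ $$\sum_{j\in A}p_jE_j\ \ge\ \frac{1}{2m}\Big(\sum_{j\in A}p_j\Big)^2+\frac12\sum_{j\in A}p_j^2\qquad\text{for all } A\subseteq L^D.$$ Define the LP midpoints $M^{LP}_j:=E^{LP}_j-p_j/2$ for $j\in L^D$, and create a priority list of the damaged lines by sorting the $M^{LP}_j$ in ascending order. Whenever a crew is free, assign to it the next line from the priority list; the first $m$ lines in the list are assigned arbitrarily to the $m$ crews. This algorithm is a $2$-approximation: if $E^H_j$ denotes the energization time of line $j$ in the schedule it constructs and $E^*_j$ the energization time of line $j$ in an optimal $m$-crew schedule, then $$\sum_{j\in L^D}w_jE^H_j\ \le\ 2\sum_{j\in L^D}w_jE^*_j.$$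
   Context: Setting: $L^D$ is a finite set of damaged lines of a radial (tree) distribution network with one source; line $l$ has repair time $p_l>0$ and weight $w_l>0$. Lines are directed away from the source. Contracting all nodes joined by intact (undamaged) lines gives a directed rooted tree whose edges are exactly the damaged lines $l=h(l)\to t(l)$, and $w_l$ is the weight of the (contracted) node $t(l)$. The soft precedence graph $P$ has node set $L^D$ and an edge $i\to j$ whenever $t(i)=h(j)$; thus $P$ is a directed forest in which each node has at most one immediate predecessor. Write $i\preceq_S j$ if $i=j$ or there is a directed path from $i$ to $j$ in $P$. An $m$-crew schedule assigns each line $l\in L^D$ to one of $m$ identical crews and a start time $S_l\ge0$; the line is repaired without interruption during $[S_l,S_l+p_l]$, each crew works on at most one line at a time, and $C_l=S_l+p_l$ is the completion time. Soft precedence does not restrict when repairs may start; the energization time is $E_j=\max_{i\preceq_S j}C_i$. The harm of a schedule is $\sum_{j\in L^D}w_jE_j$, and a schedule is optimal if it minimizes the harm among all $m$-crew schedules. The constraints in the claim are those of the linear programming relaxation whose objective is to minimize $\sum_{j\in L^D}w_jE_j$. "$\alpha$-approximation" means that the harm of the constructed schedule is at most $\alpha$ times the minimal harm.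
   Formalization: E^LP is required to be an optimal solution of the LP relaxation (minimizing the sum of w_j E_j), not any feasible one; for arbitrary feasible E^LP the claim fails, e.g. m=1, two lines leaving the source, p=(100,1), w=(1,1000), E=(100,10000). *)

theory Defs
  imports Complex_Main "Graph_Theory.Arc_Walk"
begin

text \<open>A network is a digraph whose arcs are the lines, directed away from the source; it is radial
  if it is a tree rooted at the source.\<close>

definition radial_network :: "('v, 'l) pre_digraph \<Rightarrow> 'v \<Rightarrow> bool" where
  "radial_network N s \<longleftrightarrow>
     wf_digraph N \<and> s \<in> verts N \<and> (\<forall>v\<in>verts N. \<exists>!q. pre_digraph.awalk N s q v)"

text \<open>Contraction of the intact lines. The contracted nodes are the classes of nodes that are joined
  by intact lines, irrespective of the direction of these lines.\<close>

definition intact_links :: "('v, 'l) pre_digraph \<Rightarrow> 'l set \<Rightarrow> ('v \<times> 'v) set" where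
  "intact_links N D = {(tail N l, head N l) | l. l \<in> arcs N - D}"

definition node_class :: "('v, 'l) pre_digraph \<Rightarrow> 'l set \<Rightarrow> 'v \<Rightarrow> 'v set" where
  "node_class N D v = {u. (v, u) \<in> (intact_links N D \<union> (intact_links N D)\<inverse>)\<^sup>*}"

definition contract_intact :: "('v, 'l) pre_digraph \<Rightarrow> 'l set \<Rightarrow> ('v set, 'l) pre_digraph" where
  "contract_intact N D =
     \<lparr> verts = node_class N D ` verts N,
       arcs = D,
       tail = (\<lambda>l. node_class N D (tail N l)),
       head = (\<lambda>l. node_class N D (head N l)) \<rparr>"

text \<open>Soft precedence graph of the damaged lines. A line \<open>l = h(l) \<rightarrow> t(l)\<close> leaves the node
  \<open>h(l)\<close> and enters the node \<open>t(l)\<close>, so that \<open>h(l)\<close> is \<open>tail\<close> and \<open>t(l)\<close> is \<open>head\<close> in the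
  terminology of the digraph library. The relation \<open>\<preceq>\<^sub>S\<close> is the reflexive transitive closure.\<close>

definition soft_prec :: "('v, 'l) pre_digraph \<Rightarrow> 'l set \<Rightarrow> ('l \<times> 'l) set" where
  "soft_prec N D =
     (let T = contract_intact N D
      in {(i, j). i \<in> arcs T \<and> j \<in> arcs T \<and> head T i = tail T j})"

text \<open>A schedule is given by the crew (one of \<open>0, \<dots>, m - 1\<close>) and the start time of each line.\<close>

definition crew_schedule ::
    "nat \<Rightarrow> 'l set \<Rightarrow> ('l \<Rightarrow> real) \<Rightarrow> ('l \<Rightarrow> nat) \<Rightarrow> ('l \<Rightarrow> real) \<Rightarrow> bool" where
  "crew_schedule m D p c S \<longleftrightarrow>
     (\<forall>l\<in>D. c l < m \<and> 0 \<le> S l) \<and>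
     (\<forall>i\<in>D. \<forall>j\<in>D. i \<noteq> j \<and> c i = c j \<longrightarrow> S i + p i \<le> S j \<or> S j + p j \<le> S i)"

definition energization :: "('l \<times> 'l) set \<Rightarrow> ('l \<Rightarrow> real) \<Rightarrow> ('l \<Rightarrow> real) \<Rightarrow> 'l \<Rightarrow> real" where
  "energization P p S j = Max ((\<lambda>i. S i + p i) ` {i. (i, j) \<in> P\<^sup>*})"

definition harm ::
    "'l set \<Rightarrow> ('l \<times> 'l) set \<Rightarrow> ('l \<Rightarrow> real) \<Rightarrow> ('l \<Rightarrow> real) \<Rightarrow> ('l \<Rightarrow> real) \<Rightarrow> real" where
  "harm D P p w S = (\<Sum>j\<in>D. w j * energization P p S j)"

definition optimal_schedule ::
    "nat \<Rightarrow> 'l set \<Rightarrow> ('l \<times> 'l) set \<Rightarrow> ('l \<Rightarrow> real) \<Rightarrow> ('l \<Rightarrow> real) \<Rightarrow>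
      ('l \<Rightarrow> nat) \<Rightarrow> ('l \<Rightarrow> real) \<Rightarrow> bool" where
  "optimal_schedule m D P p w c S \<longleftrightarrow>
     crew_schedule m D p c S \<and>
     (\<forall>c' S'. crew_schedule m D p c' S' \<longrightarrow> harm D P p w S \<le> harm D P p w S')"

definition lp_feasible ::
    "nat \<Rightarrow> 'l set \<Rightarrow> ('l \<times> 'l) set \<Rightarrow> ('l \<Rightarrow> real) \<Rightarrow> ('l \<Rightarrow> real) \<Rightarrow> bool" where
  "lp_feasible m D P p E \<longleftrightarrow>
     (\<forall>j\<in>D. E j \<ge> p j) \<and>
     (\<forall>(i, j)\<in>P. E j \<ge> E i) \<and>
     (\<forall>A\<subseteq>D. (\<Sum>j\<in>A. p j * E j) \<ge> 1 / (2 * real m) * (\<Sum>j\<in>A. p j)\<^sup>2 + 1 / 2 * (\<Sum>j\<in>A. (p j)\<^sup>2))"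

definition lp_optimal ::
    "nat \<Rightarrow> 'l set \<Rightarrow> ('l \<times> 'l) set \<Rightarrow> ('l \<Rightarrow> real) \<Rightarrow> ('l \<Rightarrow> real) \<Rightarrow> ('l \<Rightarrow> real) \<Rightarrow> bool" where
  "lp_optimal m D P p w E \<longleftrightarrow>
     lp_feasible m D P p E \<and>
     (\<forall>E'. lp_feasible m D P p E' \<longrightarrow> (\<Sum>j\<in>D. w j * E j) \<le> (\<Sum>j\<in>D. w j * E' j))"

definition lp_midpoint :: "('l \<Rightarrow> real) \<Rightarrow> ('l \<Rightarrow> real) \<Rightarrow> 'l \<Rightarrow> real" where
  "lp_midpoint p E j = E j - p j / 2"

text \<open>Ties between equal keys may be broken in any way.\<close>

definition priority_list :: "'l set \<Rightarrow> ('l \<Rightarrow> real) \<Rightarrow> 'l list \<Rightarrow> bool" where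
  "priority_list D M xs \<longleftrightarrow> distinct xs \<and> set xs = D \<and> sorted (map M xs)"

text \<open>The time at which crew \<open>a\<close> becomes free after the first \<open>k\<close> lines of the list have been
  assigned.\<close>

definition free_time ::
    "('l \<Rightarrow> real) \<Rightarrow> 'l list \<Rightarrow> ('l \<Rightarrow> nat) \<Rightarrow> ('l \<Rightarrow> real) \<Rightarrow> nat \<Rightarrow> nat \<Rightarrow> real" where
  "free_time p xs c S k a = Max (insert 0 ((\<lambda>l. S l + p l) ` {l \<in> set (take k xs). c l = a}))"

text \<open>List scheduling: the next line of the list goes to a crew that becomes free first, and its
  repair starts at that moment. The choice among crews that become free simultaneously is
  arbitrary. All crews are free at time \<open>0\<close>, so for positive repair times the first \<open>m\<close> lines are
  distributed arbitrarily over distinct crews.\<close>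

definition list_schedule ::
    "nat \<Rightarrow> ('l \<Rightarrow> real) \<Rightarrow> 'l list \<Rightarrow> ('l \<Rightarrow> nat) \<Rightarrow> ('l \<Rightarrow> real) \<Rightarrow> bool" where
  "list_schedule m p xs c S \<longleftrightarrow>
     (\<forall>k<length xs.
        c (xs ! k) < m \<and>
        S (xs ! k) = free_time p xs c S k (c (xs ! k)) \<and>
        (\<forall>a<m. free_time p xs c S k (c (xs ! k)) \<le> free_time p xs c S k a))"

end

theory Submission imports Defs "HOL-Analysis.Convex" begin

text \<open>The energization times of any schedule are feasible for the linear program: on one crew, the
  lines of \<open>A\<close> satisfy the inequality with \<open>m = 1\<close>, and Cauchy-Schwarz over the crews gives
  the factor \<open>1 / m\<close>. Hence the optimum of the relaxation is at most the minimal harm.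
  Conversely, let \<open>B\<close> be the set of lines up to \<open>j\<close> in the priority list. Their midpoints are at
  most that of \<open>j\<close>, so the inequality for \<open>B\<close> gives \<open>p(B) \<le> 2 m M\<^sub>j\<close>. List scheduling starts \<open>j\<close>
  no later than \<open>p(B - {j}) / m\<close>, the average load of the crews at that moment, so that
  \<open>C\<^sub>j \<le> 2 M\<^sub>j + p\<^sub>j = 2 E\<^sub>j\<close>. Monotonicity of \<open>E\<close> along the precedence graph transfers this bound
  to the energization times.\<close>

section \<open>Predecessors and energization times\<close>

lemma soft_prec_subset: "soft_prec N D \<subseteq> D \<times> D"
  by (auto simp: soft_prec_def contract_intact_def Let_def)

text \<open>A nonempty path starts in \<open>D\<close> because \<open>P\<close> lives on
  \<open>D\<close>, and the empty path starts at \<open>j\<close>. So the \<open>Max\<close> in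
  \<open>energization\<close> ranges over a finite set.\<close>

lemma rtrancl_predecessors:
  assumes "P \<subseteq> D \<times> D" "finite D" "j \<in> D"
  shows "finite {i. (i, j) \<in> P\<^sup>*}" "{i. (i, j) \<in> P\<^sup>*} \<subseteq> D"
proof -
  show "{i. (i, j) \<in> P\<^sup>*} \<subseteq> D"
    using assms by (auto elim: converse_rtranclE)
  then show "finite {i. (i, j) \<in> P\<^sup>*}"
    using assms(2) finite_subset by blast
qed

lemma energization_ge:
  assumes "P \<subseteq> D \<times> D" "finite D" "j \<in> D" "(i, j) \<in> P\<^sup>*"
  shows "S i + p i \<le> energization P p S j"
  unfolding energization_def
  using rtrancl_predecessors[OF assms(1-3)] assms(4) by (intro Max_ge) auto

lemma energization_le:
  assumes "P \<subseteq> D \<times> D" "finite D" "j \<in> D"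
    and "\<And>i. (i, j) \<in> P\<^sup>* \<Longrightarrow> S i + p i \<le> b"
  shows "energization P p S j \<le> b"
  unfolding energization_def
  using rtrancl_predecessors[OF assms(1-3)] assms(4) by (subst Max_le_iff) auto

lemma energization_mono:
  assumes "P \<subseteq> D \<times> D" "finite D" "(i, j) \<in> P\<^sup>*" "i \<in> D" "j \<in> D"
  shows "energization P p S i \<le> energization P p S j"
  by (rule energization_le[OF assms(1,2,4)])
     (use energization_ge[OF assms(1,2,5)] assms(3) rtrancl_trans in metis)

section \<open>Disjoint repairs on a single crew\<close>

definition disjoint_repairs :: "'l set \<Rightarrow> ('l \<Rightarrow> real) \<Rightarrow> ('l \<Rightarrow> real) \<Rightarrow> bool" where
  "disjoint_repairs A p S \<longleftrightarrow>
     (\<forall>i\<in>A. 0 < p i \<and> 0 \<le> S i) \<and>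
     (\<forall>i\<in>A. \<forall>j\<in>A. i \<noteq> j \<longrightarrow> S i + p i \<le> S j \<or> S j + p j \<le> S i)"

text \<open>The opposite order would give \<open>S x + p x \<le> S y < S y + p y\<close>, against
  the assumption that \<open>y\<close> does not finish after \<open>x\<close>.\<close>

lemma disjoint_repairs_last:
  assumes "disjoint_repairs (insert x A) p S" "x \<notin> A" "y \<in> A" "S y + p y \<le> S x + p x"
  shows "S y + p y \<le> S x"
proof -
  have "0 < p y" and "S y + p y \<le> S x \<or> S x + p x \<le> S y"
    using assms(1-3) by (auto simp: disjoint_repairs_def)
  then show ?thesis using assms(4) by linarith
qed

lemma disjoint_repairs_insert: "disjoint_repairs (insert x A) p S \<Longrightarrow> disjoint_repairs A p S"
  by (auto simp: disjoint_repairs_def)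

text \<open>Lines are added in order of completion. The earlier ones all finish before the last line
  \<open>x\<close> starts, so the induction hypothesis applies with the deadline
  \<open>S x\<close>.\<close>

lemma disjoint_repairs_total:
  assumes "finite A" "disjoint_repairs A p S" "0 \<le> T" "\<And>i. i \<in> A \<Longrightarrow> S i + p i \<le> T"
  shows "sum p A \<le> T"
  using assms
proof (induction A arbitrary: T rule: finite_ranking_induct[where f = "\<lambda>i. S i + p i"])
  case empty
  then show ?case by simp
next
  case (insert x A)
  show ?case
  \<comment> \<open>The ranking induction does not provide \<open>x \<notin> A\<close>.\<close>
  proof (cases "x \<in> A")
    case True
    then show ?thesis using insert by (simp add: insert_absorb)
  next
    case False
    have "sum p A \<le> S x"
    proof (rule insert.IH)
      show "disjoint_repairs A p S" by (rule disjoint_repairs_insert[OF insert.prems(1)])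
      show "0 \<le> S x" using insert.prems(1) by (simp add: disjoint_repairs_def)
      show "S i + p i \<le> S x" if "i \<in> A" for i
        using disjoint_repairs_last[OF insert.prems(1) False that] insert.hyps(2)[OF that] by simp
    qed
    then show ?thesis
      using insert.prems(3)[of x] insert.hyps(1) False by simp
  qed
qed

text \<open>A new last line \<open>x\<close> raises the left side by exactly
  \<open>p x * (sum p A + p x)\<close>, and its completion time is at least
  \<open>sum p A + p x\<close>.\<close>

lemma disjoint_repairs_completion:
  assumes "finite A" "disjoint_repairs A p S"
  shows "1 / 2 * (sum p A)\<^sup>2 + 1 / 2 * (\<Sum>j\<in>A. (p j)\<^sup>2) \<le> (\<Sum>j\<in>A. p j * (S j + p j))"
  using assms
proof (induction A rule: finite_ranking_induct[where f = "\<lambda>i. S i + p i"])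
  case empty
  then show ?case by simp
next
  case (insert x A)
  show ?case
  proof (cases "x \<in> A")
    case True
    then show ?thesis using insert by (simp add: insert_absorb)
  next
    case False
    have *: "disjoint_repairs A p S" by (rule disjoint_repairs_insert[OF insert.prems])
    have x: "0 < p x" "0 \<le> S x"
      using insert.prems by (auto simp: disjoint_repairs_def)
    have "sum p A \<le> S x"
      by (rule disjoint_repairs_total[OF insert.hyps(1) * x(2)])
         (use disjoint_repairs_last[OF insert.prems False] insert.hyps(2) in blast)
    then have "p x * (sum p A + p x) \<le> p x * (S x + p x)"
      using x(1) by simp
    then show ?thesis
      using insert.IH[OF *] insert.hyps(1) False
      by (simp add: power2_eq_square algebra_simps)
  qed
qed

section \<open>Validity of the relaxation for \<open>m\<close> crews\<close>

lemma schedule_completion: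
  assumes "finite D" "\<And>l. l \<in> D \<Longrightarrow> 0 < p l" "crew_schedule m D p c S" "A \<subseteq> D"
  shows "1 / (2 * real m) * (sum p A)\<^sup>2 + 1 / 2 * (\<Sum>j\<in>A. (p j)\<^sup>2) \<le> (\<Sum>j\<in>A. p j * (S j + p j))"
proof -
  define B where "B a = {l \<in> A. c l = a}" for a
  have finA: "finite A" using assms(1,4) finite_subset by blast
  \<comment> \<open>The sets \<open>B a\<close> partition \<open>A\<close>, since every crew index
    is below \<open>m\<close>.\<close>
  have sumB: "(\<Sum>a<m. sum f (B a)) = sum f A" for f :: "_ \<Rightarrow> real"
    unfolding B_def using assms(3,4) finA
    by (intro sum.group) (auto simp: crew_schedule_def)
  have disj: "disjoint_repairs (B a) p S" for a
    using assms(2-4) by (auto simp: disjoint_repairs_def crew_schedule_def B_def subset_iff)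
  have "(sum p A)\<^sup>2 \<le> real m * (\<Sum>a<m. (sum p (B a))\<^sup>2)"
    using sum_squared_le_sum_of_squares[of "\<lambda>a. sum p (B a)" "{..<m}"]
    by (simp add: sumB mult.commute)
  \<comment> \<open>For \<open>m = 0\<close> both sides are 0, the left one because division by zero
    yields 0.\<close>
  then have "1 / (2 * real m) * (sum p A)\<^sup>2 \<le> 1 / 2 * (\<Sum>a<m. (sum p (B a))\<^sup>2)"
    by (cases "m = 0") (auto simp: field_simps sum_nonneg)
  then have "1 / (2 * real m) * (sum p A)\<^sup>2 + 1 / 2 * (\<Sum>j\<in>A. (p j)\<^sup>2)
      \<le> (\<Sum>a<m. 1 / 2 * (sum p (B a))\<^sup>2 + 1 / 2 * (\<Sum>j\<in>B a. (p j)\<^sup>2))"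
    by (simp add: sum.distrib sum_distrib_left[symmetric] sumB flip: sum_divide_distrib)
  also have "\<dots> \<le> (\<Sum>a<m. \<Sum>j\<in>B a. p j * (S j + p j))"
    using finA by (intro sum_mono disjoint_repairs_completion disj) (simp add: B_def)
  finally show ?thesis by (simp add: sumB)
qed

lemma schedule_lp_feasible:
  assumes "P \<subseteq> D \<times> D" "finite D" "\<And>l. l \<in> D \<Longrightarrow> 0 < p l" "crew_schedule m D p c S"
  shows "lp_feasible m D P p (energization P p S)"
proof -
  have C: "S j + p j \<le> energization P p S j" if "j \<in> D" for j
    using energization_ge[OF assms(1,2) that] by blast
  have "p j \<le> energization P p S j" if "j \<in> D" for j
    using C[OF that] assms(4) that by (fastforce simp: crew_schedule_def)
  moreover have "energization P p S i \<le> energization P p S j" if "(i, j) \<in> P" for i j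
    using energization_mono[OF assms(1,2), of i j] that assms(1) by blast
  moreover have "1 / (2 * real m) * (sum p A)\<^sup>2 + 1 / 2 * (\<Sum>j\<in>A. (p j)\<^sup>2)
      \<le> (\<Sum>j\<in>A. p j * energization P p S j)" if "A \<subseteq> D" for A
  proof -
    have "(\<Sum>j\<in>A. p j * (S j + p j)) \<le> (\<Sum>j\<in>A. p j * energization P p S j)"
      using C assms(3) that by (intro sum_mono mult_left_mono) (auto simp: less_imp_le subset_iff)
    then show ?thesis
      using schedule_completion[OF assms(2-4) that] by linarith
  qed
  ultimately show ?thesis by (auto simp: lp_feasible_def)
qed

section \<open>Start times under list scheduling\<close>

lemma free_time_Suc:
  assumes "k < length xs" "S (xs ! k) = free_time p xs c S k (c (xs ! k))" "0 < p (xs ! k)"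
  shows "free_time p xs c S (Suc k) a =
           free_time p xs c S k a + (if a = c (xs ! k) then p (xs ! k) else 0)"
proof (cases "a = c (xs ! k)")
  case True
  define F where "F = (\<lambda>l. S l + p l) ` {l \<in> set (take k xs). c l = a}"
  have "{l \<in> set (take (Suc k) xs). c l = a} = insert (xs ! k) {l \<in> set (take k xs). c l = a}"
    using assms(1) True by (auto simp: take_Suc_conv_app_nth)
  then have "free_time p xs c S (Suc k) a = Max (insert (S (xs ! k) + p (xs ! k)) (insert 0 F))"
    by (simp add: free_time_def F_def insert_commute)
  also have "\<dots> = max (S (xs ! k) + p (xs ! k)) (Max (insert 0 F))"
    by (rule Max_insert) (auto simp: F_def)
  also have "Max (insert 0 F) = free_time p xs c S k a"
    by (simp add: free_time_def F_def)
  \<comment> \<open>The line starts exactly when its crew becomes free and \<open>p (xs ! k)\<close>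
    is positive, so the maximum is the new completion time.\<close>
  finally show ?thesis using assms(2,3) True by simp
next
  case False
  have "{l \<in> set (take (Suc k) xs). c l = a} = {l \<in> set (take k xs). c l = a}"
    using assms(1) False by (auto simp: take_Suc_conv_app_nth)
  then show ?thesis using False by (simp add: free_time_def)
qed

text \<open>Crews never idle between lines, so each assignment raises the total of the free times by
  just the repair time of the line.\<close>

lemma sum_free_time:
  assumes "list_schedule m p xs c S" "\<And>l. l \<in> set xs \<Longrightarrow> 0 < p l" "k \<le> length xs"
  shows "(\<Sum>a<m. free_time p xs c S k a) = (\<Sum>i<k. p (xs ! i))"
  using assms(3)
proof (induction k)
  case 0
  then show ?case by (simp add: free_time_def)
next
  case (Suc k)
  then have k: "k < length xs" by simp
  have "c (xs ! k) < m" "S (xs ! k) = free_time p xs c S k (c (xs ! k))"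
    using assms(1) k by (auto simp: list_schedule_def)
  then show ?case
    using Suc k assms(2) by (simp add: free_time_Suc sum.distrib)
qed

text \<open>The chosen crew has the least free time, which is at most the average over all
  crews.\<close>

lemma list_schedule_start_le:
  assumes "list_schedule m p xs c S" "\<And>l. l \<in> set xs \<Longrightarrow> 0 < p l" "k < length xs"
  shows "real m * S (xs ! k) \<le> (\<Sum>i<k. p (xs ! i))"
proof -
  have "real m * S (xs ! k) = (\<Sum>a<m. S (xs ! k))" by simp
  also have "\<dots> \<le> (\<Sum>a<m. free_time p xs c S k a)"
    using assms(1,3) by (intro sum_mono) (auto simp: list_schedule_def)
  finally show ?thesis using sum_free_time[OF assms(1,2)] assms(3) by simp
qed

section \<open>Comparison of list scheduling with the relaxation\<close>

lemma lp_midpoint_lower_bound: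
  assumes "lp_feasible m D P p E" "A \<subseteq> D" "finite A" "j \<in> A" "m \<ge> 1"
    and pos: "\<And>l. l \<in> A \<Longrightarrow> 0 < p l"
    and "\<And>i. i \<in> A \<Longrightarrow> lp_midpoint p E i \<le> lp_midpoint p E j"
  shows "sum p A \<le> 2 * real m * lp_midpoint p E j"
proof -
  have sum_pos: "0 < sum p A" using assms(3,4) pos by (intro sum_pos) auto
  have "1 / (2 * real m) * (sum p A)\<^sup>2 + 1 / 2 * (\<Sum>j\<in>A. (p j)\<^sup>2) \<le> (\<Sum>j\<in>A. p j * E j)"
    using assms(1,2) by (simp add: lp_feasible_def)
  \<comment> \<open>Passing from \<open>E\<close> to midpoints splits off the same sum of squares as
    on the left, so it cancels and only the square of \<open>sum p A\<close> remains.\<close>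
  also have "(\<Sum>j\<in>A. p j * E j) = (\<Sum>j\<in>A. p j * lp_midpoint p E j) + 1 / 2 * (\<Sum>j\<in>A. (p j)\<^sup>2)"
    unfolding sum_distrib_left sum.distrib[symmetric]
    by (intro sum.cong) (auto simp: lp_midpoint_def power2_eq_square algebra_simps)
  finally have "1 / (2 * real m) * (sum p A)\<^sup>2 \<le> (\<Sum>j\<in>A. p j * lp_midpoint p E j)" by simp
  also have "\<dots> \<le> sum p A * lp_midpoint p E j"
    unfolding sum_distrib_right
    using pos assms(7) by (intro sum_mono mult_left_mono) (auto simp: less_imp_le)
  finally have "sum p A * sum p A \<le> sum p A * (2 * real m * lp_midpoint p E j)"
    using assms(5) by (simp add: power2_eq_square field_simps)
  then show ?thesis using sum_pos by simp
qed

lemma list_schedule_completion_le: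
  assumes "lp_feasible m D P p E" "priority_list D (lp_midpoint p E) xs" "list_schedule m p xs c S"
    and pos: "\<And>l. l \<in> D \<Longrightarrow> 0 < p l" and "m \<ge> 1" "j \<in> D"
  shows "S j + p j \<le> 2 * E j"
proof -
  have xs: "distinct xs" "set xs = D" "sorted (map (lp_midpoint p E) xs)"
    using assms(2) by (auto simp: priority_list_def)
  then obtain k where k: "k < length xs" "xs ! k = j"
    using assms(6) by (metis in_set_conv_nth)
  \<comment> \<open>\<open>A\<close> is the list prefix ending with \<open>j\<close>; by sortedness,
    \<open>j\<close> has its largest midpoint.\<close>
  define A where "A = (!) xs ` {..k}"
  have "inj_on ((!) xs) {..k}"
    using xs(1) k(1) by (intro inj_on_nth) auto
  then have "sum p A = (\<Sum>i\<le>k. p (xs ! i))"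
    by (simp add: A_def sum.reindex)
  then have sumA: "sum p A = (\<Sum>i<k. p (xs ! i)) + p j"
    using k(2) by (simp add: lessThan_Suc_atMost[symmetric])
  have "A \<subseteq> D" using k(1) xs(2) by (auto simp: A_def)
  moreover have "lp_midpoint p E i \<le> lp_midpoint p E j" if "i \<in> A" for i
    using that k sorted_nth_mono[OF xs(3)] by (auto simp: A_def)
  ultimately have "sum p A \<le> 2 * real m * lp_midpoint p E j"
    using assms(1,5) k(2) pos by (intro lp_midpoint_lower_bound[where D = D and P = P]) (auto simp: A_def)
  moreover have "real m * S j \<le> (\<Sum>i<k. p (xs ! i))"
    using list_schedule_start_le[OF assms(3) _ k(1)] pos xs(2) k(2) by simp
  \<comment> \<open>The surplus \<open>p j\<close> in \<open>sum p A\<close> is positive and is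
    dropped.\<close>
  ultimately have "real m * S j \<le> real m * (2 * lp_midpoint p E j)"
    using sumA pos[OF assms(6)] by simp
  then have "S j \<le> 2 * lp_midpoint p E j" using assms(5) by simp
  then show ?thesis by (simp add: lp_midpoint_def)
qed

lemma lp_feasible_rtrancl_mono:
  assumes "lp_feasible m D P p E" "(i, j) \<in> P\<^sup>*"
  shows "E i \<le> E j"
  using assms(2)
proof (induction rule: rtrancl_induct)
  case (step y z)
  then have "E y \<le> E z" using assms(1) by (auto simp: lp_feasible_def)
  then show ?case using step.IH by simp
qed simp

theorem theorem3:
  fixes N :: "('v, 'l) pre_digraph" and s :: 'v and D :: "'l set"
    and p w :: "'l \<Rightarrow> real" and m :: nat
    and E_LP :: "'l \<Rightarrow> real" and xs :: "'l list"
    and c\<^sub>H c\<^sub>O :: "'l \<Rightarrow> nat" and S\<^sub>H S\<^sub>O :: "'l \<Rightarrow> real"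
  assumes "radial_network N s"
    and "D \<subseteq> arcs N" and "finite D"
    and "\<And>l. l \<in> D \<Longrightarrow> p l > 0" and "\<And>l. l \<in> D \<Longrightarrow> w l > 0"
    and "m \<ge> 1"
    and "lp_optimal m D (soft_prec N D) p w E_LP"
    and "priority_list D (lp_midpoint p E_LP) xs"
    and "list_schedule m p xs c\<^sub>H S\<^sub>H"
    and "optimal_schedule m D (soft_prec N D) p w c\<^sub>O S\<^sub>O"
  shows "(\<Sum>j\<in>D. w j * energization (soft_prec N D) p S\<^sub>H j)
           \<le> 2 * (\<Sum>j\<in>D. w j * energization (soft_prec N D) p S\<^sub>O j)"
proof -
  let ?P = "soft_prec N D"
  have P: "?P \<subseteq> D \<times> D" by (rule soft_prec_subset)
  have feasible: "lp_feasible m D ?P p E_LP"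
    using assms(7) by (simp add: lp_optimal_def)
  have "energization ?P p S\<^sub>H j \<le> 2 * E_LP j" if "j \<in> D" for j
  proof (rule energization_le[OF P assms(3) that])
    fix i assume i: "(i, j) \<in> ?P\<^sup>*"
    then have "i \<in> D" using rtrancl_predecessors[OF P assms(3) that] by blast
    then have "S\<^sub>H i + p i \<le> 2 * E_LP i"
      using list_schedule_completion_le[OF feasible assms(8,9,4,6)] by blast
    then show "S\<^sub>H i + p i \<le> 2 * E_LP j"
      using lp_feasible_rtrancl_mono[OF feasible i] by simp
  qed
  then have "(\<Sum>j\<in>D. w j * energization ?P p S\<^sub>H j) \<le> (\<Sum>j\<in>D. w j * (2 * E_LP j))"
    using assms(5) by (intro sum_mono mult_left_mono) (auto simp: less_imp_le)
  also have "\<dots> = 2 * (\<Sum>j\<in>D. w j * E_LP j)"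
    by (simp add: sum_distrib_left mult.left_commute)
  \<comment> \<open>Here the minimality of \<open>E_LP\<close> enters: the energization times of
    \<open>S\<^sub>O\<close> are a feasible competitor.\<close>
  also have "(\<Sum>j\<in>D. w j * E_LP j) \<le> (\<Sum>j\<in>D. w j * energization ?P p S\<^sub>O j)"
    using assms(7,10) schedule_lp_feasible[OF P assms(3,4)]
    by (auto simp: lp_optimal_def optimal_schedule_def)
  finally show ?thesis by simp
qed

end
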